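(* Let $\phi:\mathbb{R}\to\mathbb{R}$ be any increasing function such that $\phi(0)=0$. Then $z\in\mathbb{R}^n$ solves the nonlinear complementarity problem $$z\ge 0,\qquad f(z)\ge 0,\qquad z^T f(z)=0$$ if and only if $$\phi\big((f_i(z)-z_i)^2\big)-\phi\big(f_i(z)\,|f_i(z)|\big)-\phi\big(z_i|z_i|\big)=0\qquad\text{for all } i\in\{1,2,\dots,n\}.$$
   Context: Here $f:\mathbb{R}^n\to\mathbb{R}^n$ is a nonlinear function with components $f_1,\dots,f_n$, and $z_i$ denotes the $i$-th component of $z$. Vector inequalities are componentwise: $z\ge 0$ means $z_i\ge 0$ for all $i$, and likewise for $f(z)\ge 0$. *)

theory Defs
  imports "HOL-Analysis.Analysis"
begin

(* The order on real ^ 'n is the componentwise one (less_eq_vec_def), and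
   the inner product is the standard one (inner_vec_def). *)
definition solves_NCP :: "(real ^ 'n \<Rightarrow> real ^ 'n) \<Rightarrow> real ^ 'n \<Rightarrow> bool" where
  "solves_NCP f z \<longleftrightarrow> z \<ge> 0 \<and> f z \<ge> 0 \<and> z \<bullet> f z = 0"

end

theory Submission
  imports Defs
begin

text \<open>The problem decouples into coordinates: for nonnegative vectors the inner product
  vanishes iff every product of components does. What remains is a fact about two reals
  \<open>a\<close> and \<open>b\<close>, \<open>complementarity_scalar_iff\<close>. The signed
  square \<open>x * \<bar>x\<bar>\<close> keeps the sign of \<open>x\<close>, and so does its image
  under \<open>\<phi>\<close>; comparing it with \<open>(a - b)\<^sup>2\<close> rules out a negative
  number and then two positive ones. Strictness matters: for constant \<open>\<phi>\<close> = 0 the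
  equation always holds.\<close>

lemma complementarity_scalar_nonneg:
  fixes \<phi> :: "real \<Rightarrow> real"
  assumes mono: "strict_mono \<phi>" and zero: "\<phi> 0 = 0"
    and eq: "\<phi> ((a - b)\<^sup>2) = \<phi> (a * \<bar>a\<bar>) + \<phi> (b * \<bar>b\<bar>)"
  shows "0 \<le> a"
proof (rule ccontr)
  assume "\<not> 0 \<le> a"
  then have a: "a < 0" by simp
  then have "a * \<bar>a\<bar> < 0" by (intro mult_neg_pos) auto
  then have "\<phi> (a * \<bar>a\<bar>) < 0"
    using strict_monoD[OF mono] zero by metis
  \<comment> \<open>For \<open>b\<close> \<ge> 0, subtracting the negative \<open>a\<close> only
    moves \<open>b\<close> further from 0; for \<open>b\<close> < 0 the left side is not
    positive.\<close>
  moreover have "b * \<bar>b\<bar> \<le> (a - b)\<^sup>2"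
  proof (cases "0 \<le> b")
    case True
    then have "b\<^sup>2 \<le> (b - a)\<^sup>2" using a by (intro power_mono) auto
    then show ?thesis using True by (simp add: power2_commute[of a b] power2_eq_square[of b])
  next
    case False
    then have "b * \<bar>b\<bar> \<le> 0" by (intro mult_nonpos_nonneg) auto
    then show ?thesis using zero_le_power2[of "a - b"] by linarith
  qed
  then have "\<phi> (b * \<bar>b\<bar>) \<le> \<phi> ((a - b)\<^sup>2)"
    using mono by (simp add: strict_mono_less_eq)
  ultimately show False using eq by linarith
qed

text \<open>If \<open>b\<close> were positive, then 0 \<le> \<open>a - b\<close> \<le>
  \<open>a\<close> would bound the left side of the equation by
  \<open>\<phi> (a * \<bar>a\<bar>)\<close>, leaving no room for the positive term
  \<open>\<phi> (b * \<bar>b\<bar>)\<close>.\<close>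

lemma complementarity_scalar_zero:
  fixes \<phi> :: "real \<Rightarrow> real"
  assumes mono: "strict_mono \<phi>" and zero: "\<phi> 0 = 0"
    and eq: "\<phi> ((a - b)\<^sup>2) = \<phi> (a * \<bar>a\<bar>) + \<phi> (b * \<bar>b\<bar>)"
    and "0 \<le> b" "b \<le> a"
  shows "b = 0"
proof (rule ccontr)
  assume "b \<noteq> 0"
  with \<open>0 \<le> b\<close> have b: "0 < b" by simp
  then have "0 < \<phi> (b * \<bar>b\<bar>)"
    using strict_monoD[OF mono, of 0 "b * \<bar>b\<bar>"] zero by simp
  moreover have "(a - b)\<^sup>2 \<le> a\<^sup>2"
    using b \<open>b \<le> a\<close> by (intro power_mono) auto
  then have "\<phi> ((a - b)\<^sup>2) \<le> \<phi> (a * \<bar>a\<bar>)"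
    using mono b \<open>b \<le> a\<close> by (simp add: strict_mono_less_eq power2_eq_square)
  ultimately show False using eq by linarith
qed

lemma complementarity_scalar_iff:
  fixes \<phi> :: "real \<Rightarrow> real"
  assumes mono: "strict_mono \<phi>" and zero: "\<phi> 0 = 0"
  shows "\<phi> ((a - b)\<^sup>2) - \<phi> (a * \<bar>a\<bar>) - \<phi> (b * \<bar>b\<bar>) = 0 \<longleftrightarrow>
    0 \<le> a \<and> 0 \<le> b \<and> a * b = 0" (is "?L \<longleftrightarrow> ?R")
proof
  assume ?L
  then have ab: "\<phi> ((a - b)\<^sup>2) = \<phi> (a * \<bar>a\<bar>) + \<phi> (b * \<bar>b\<bar>)" by simp
  \<comment> \<open>The equation is symmetric in \<open>a\<close> and \<open>b\<close>, so both
    lemmas also apply with the roles exchanged; the smaller of the two numbers is then 0.\<close>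
  then have ba: "\<phi> ((b - a)\<^sup>2) = \<phi> (b * \<bar>b\<bar>) + \<phi> (a * \<bar>a\<bar>)"
    by (simp add: power2_commute[of b a])
  note nonneg = complementarity_scalar_nonneg[OF mono zero ab]
    complementarity_scalar_nonneg[OF mono zero ba]
  moreover have "a = 0 \<or> b = 0"
    using complementarity_scalar_zero[OF mono zero ab nonneg(2)]
      complementarity_scalar_zero[OF mono zero ba nonneg(1)] linear[of a b] by argo
  ultimately show ?R by auto
next
  assume ?R
  \<comment> \<open>One number is 0 and the other is nonnegative, so its signed square equals the
    squared difference.\<close>
  then show ?L using zero by (auto simp: power2_eq_square)
qed

theorem theorem1:
  fixes f :: "real ^ 'n \<Rightarrow> real ^ 'n"
    and \<phi> :: "real \<Rightarrow> real"
    and z :: "real ^ 'n"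
  assumes "strict_mono \<phi>"
    and "\<phi> 0 = 0"
  shows "solves_NCP f z \<longleftrightarrow>
    (\<forall>i. \<phi> ((f z $ i - z $ i)\<^sup>2) - \<phi> (f z $ i * \<bar>f z $ i\<bar>) - \<phi> (z $ i * \<bar>z $ i\<bar>) = 0)"
proof -
  \<comment> \<open>A sum of nonnegative terms vanishes only if each term does.\<close>
  have "z \<bullet> f z = 0 \<longleftrightarrow> (\<forall>i. f z $ i * z $ i = 0)" if "0 \<le> z" "0 \<le> f z"
    using that
    by (simp add: inner_vec_def less_eq_vec_def sum_nonneg_eq_0_iff mult.commute disj_commute)
  then have "solves_NCP f z \<longleftrightarrow> (\<forall>i. 0 \<le> f z $ i \<and> 0 \<le> z $ i \<and> f z $ i * z $ i = 0)"
    unfolding solves_NCP_def less_eq_vec_def by auto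
  then show ?thesis
    unfolding complementarity_scalar_iff[OF assms] .
qed

end
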